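(* Let $p$ be an odd prime and let $\{A_n\}_{n\ge0}$ be a sequence of rational numbers with $A_0,A_1,\ldots,A_{(p-1)/2}$ rational $p$-integers. If $\{A_n\}$ is an even sequence and $p\equiv3\pmod4$, or if $\{A_n\}$ is an odd sequence and $p\equiv1\pmod4$, then $$\sum_{k=0}^{(p-1)/2}\frac{\binom{2k}{k}}{2^k}A_k\equiv0\pmod p.$$
   Context: A sequence $\{a_n\}_{n\ge0}$ is called an even sequence if $\sum_{k=0}^n\binom nk(-1)^ka_k=a_n$ for all $n=0,1,2,\ldots$, and an odd sequence if $\sum_{k=0}^n\binom nk(-1)^ka_k=-a_n$ for all $n=0,1,2,\ldots$. A rational $p$-integer is a rational number whose denominator (in lowest terms) is coprime to $p$; $\mathbb Z_p$ denotes the ring of such numbers, and for $x,y\in\mathbb Z_p$, $x\equiv y\pmod p$ means $(x-y)/p\in\mathbb Z_p$. *)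

theory Defs
  imports Complex_Main "HOL-Computational_Algebra.Primes"
begin

definition even_sequence :: "(nat \<Rightarrow> rat) \<Rightarrow> bool" where
  "even_sequence a \<longleftrightarrow> (\<forall>n. (\<Sum>k=0..n. of_nat (n choose k) * (-1) ^ k * a k) = a n)"

definition odd_sequence :: "(nat \<Rightarrow> rat) \<Rightarrow> bool" where
  "odd_sequence a \<longleftrightarrow> (\<forall>n. (\<Sum>k=0..n. of_nat (n choose k) * (-1) ^ k * a k) = - a n)"

(* quotient_of returns the fraction in lowest terms, with positive denominator. *)
definition p_integers :: "nat \<Rightarrow> rat set" where
  "p_integers p = {x. coprime (snd (quotient_of x)) (int p)}"

(* Congruence is only meaningful between p-integers, so membership of both sides is part of it. *)
definition p_cong :: "nat \<Rightarrow> rat \<Rightarrow> rat \<Rightarrow> bool" where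
  "p_cong p x y \<longleftrightarrow>
     x \<in> p_integers p \<and> y \<in> p_integers p \<and> (x - y) / of_nat p \<in> p_integers p"

end

theory Submission
  imports Defs "HOL-Number_Theory.Cong"
begin

text \<open>
  Put \<open>m = (p - 1) div 2\<close>. Since \<open>m\<close> is congruent to \<open>-1/2\<close> modulo \<open>p\<close>, the coefficient
  \<open>(2k choose k) / 2^k = (-1/2 gchoose k) * (-2)^k\<close> may be replaced by \<open>(m choose k) * (-2)^k\<close>.
  Umbrally the resulting sum is \<open>(1 - 2A)^m\<close>. The binomial transform substitutes \<open>1 - A\<close> for \<open>A\<close>
  and so multiplies it by \<open>(-1)^m\<close>; in both cases of the theorem this sign is opposite to that
  by which the transform acts on \<open>A\<close>, and the new sum vanishes exactly.
\<close>

text \<open>Any fraction with denominator coprime to \<open>p\<close> will do, reduced or not, so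
  the closure properties below need no reduction to lowest terms.\<close>

lemma p_integers_iff:
  "x \<in> p_integers p \<longleftrightarrow> (\<exists>a b. x = of_int a / of_int b \<and> b \<noteq> 0 \<and> coprime b (int p))"
proof
  assume x: "x \<in> p_integers p"
  obtain a b where q: "quotient_of x = (a, b)"
    by (cases "quotient_of x")
  have "x = of_int a / of_int b" and "b > 0"
    using quotient_of_div[OF q] quotient_of_denom_pos[OF q] by auto
  then show "\<exists>a b. x = of_int a / of_int b \<and> b \<noteq> 0 \<and> coprime b (int p)"
    using x q by (auto simp: p_integers_def)
next
  assume "\<exists>a b. x = of_int a / of_int b \<and> b \<noteq> 0 \<and> coprime b (int p)"
  then obtain a b where x: "x = of_int a / of_int b" and b: "b \<noteq> 0" "coprime b (int p)"
    by blast
  obtain c d where q: "quotient_of x = (c, d)"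
    by (cases "quotient_of x")
  have d: "d > 0" "coprime c d" "x = of_int c / of_int d"
    using quotient_of_denom_pos[OF q] quotient_of_coprime[OF q] quotient_of_div[OF q] by auto
  have "of_int (a * d) = (of_int (c * b) :: rat)"
    using x d b by (simp add: field_simps)
  then have "a * d = c * b"
    by (simp only: of_int_eq_iff)
  \<comment> \<open>The reduced denominator \<open>d\<close> is coprime to \<open>c\<close>, so it
    divides \<open>b\<close> and inherits coprimality to \<open>p\<close>.\<close>
  then have "d dvd c * b"
    by (metis dvd_triv_right)
  then have "d dvd b"
    using d(2) by (simp add: coprime_commute coprime_dvd_mult_right_iff)
  then show "x \<in> p_integers p"
    using coprime_divisors[OF _ dvd_refl b(2)] q by (simp add: p_integers_def)
qed

lemma p_integers_divide_int:
  "b \<noteq> 0 \<Longrightarrow> coprime b (int p) \<Longrightarrow> of_int a / of_int b \<in> p_integers p"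
  unfolding p_integers_iff by blast

lemma p_integers_of_int: "of_int a \<in> p_integers p"
  using p_integers_divide_int[of 1 p a] by simp

lemma p_integers_add:
  assumes "x \<in> p_integers p" "y \<in> p_integers p"
  shows "x + y \<in> p_integers p"
proof -
  obtain a b c d where x: "x = of_int a / of_int b" "b \<noteq> 0" "coprime b (int p)"
    and y: "y = of_int c / of_int d" "d \<noteq> 0" "coprime d (int p)"
    using assms unfolding p_integers_iff by blast
  have "x + y = of_int (a * d + c * b) / of_int (b * d)"
    using x y by (simp add: field_simps)
  also have "\<dots> \<in> p_integers p"
    using x y by (intro p_integers_divide_int) auto
  finally show ?thesis .
qed

lemma p_integers_mult:
  assumes "x \<in> p_integers p" "y \<in> p_integers p"
  shows "x * y \<in> p_integers p"
proof -
  obtain a b c d where x: "x = of_int a / of_int b" "b \<noteq> 0" "coprime b (int p)"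
    and y: "y = of_int c / of_int d" "d \<noteq> 0" "coprime d (int p)"
    using assms unfolding p_integers_iff by blast
  have "x * y = of_int (a * c) / of_int (b * d)"
    using x y by simp
  also have "\<dots> \<in> p_integers p"
    using x y by (intro p_integers_divide_int) auto
  finally show ?thesis .
qed

lemma p_integers_sum:
  "(\<And>i. i \<in> I \<Longrightarrow> f i \<in> p_integers p) \<Longrightarrow> sum f I \<in> p_integers p"
  using p_integers_of_int[of 0 p]
  by (induction I rule: infinite_finite_induct) (simp_all add: p_integers_add)

lemma Suc_times_central_binomial:
  "Suc k * (2 * Suc k choose Suc k) = 2 * (2 * k + 1) * (2 * k choose k)"
proof -
  have "Suc k * (2 * Suc k choose Suc k) = 2 * (Suc k * (Suc (2 * k) choose k))"
    using Suc_times_binomial_eq[of "2 * k + 1" k] by (simp add: algebra_simps)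
  \<comment> \<open>The symmetry \<open>k + Suc k = 2 * k + 1\<close> makes absorption applicable a
    second time.\<close>
  also have "Suc (2 * k) choose k = Suc (2 * k) choose Suc k"
    using binomial_symmetric[of k "Suc (2 * k)"] by simp
  also have "Suc k * (Suc (2 * k) choose Suc k) = Suc (2 * k) * (2 * k choose k)"
    using Suc_times_binomial_eq[of "2 * k" k] by (simp add: algebra_simps)
  finally show ?thesis by simp
qed

text \<open>Both sides are 1 at \<open>k = 0\<close> and satisfy first-order recurrences, with
  ratios \<open>2 * (2 * k + 1) / (k + 1)\<close> and \<open>-4 * (m - k) / (k + 1)\<close> for
  \<open>m = (p - 1) div 2\<close>. The numerators agree modulo \<open>p\<close> because
  \<open>2 * m\<close> is congruent to -1.\<close>

lemma central_binomial_cong: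
  fixes p :: nat
  assumes "prime p" "odd p" "k < p"
  shows "[int (2 * k choose k) = int (((p - 1) div 2) choose k) * (-4) ^ k] (mod int p)"
  using assms(3)
proof (induction k)
  case 0
  then show ?case by simp
next
  case (Suc k)
  define m where "m = (p - 1) div 2"
  have p: "int p = 2 * int m + 1"
    using assms(2) unfolding m_def by (elim oddE) simp
  \<comment> \<open>The subtraction is taken in the integers, since \<open>k\<close> may exceed
    \<open>m\<close>; both binomials then vanish.\<close>
  have step: "int (Suc k) * int (m choose Suc k) = (int m - int k) * int (m choose k)"
  proof (cases "k \<le> m")
    case True
    have "Suc k * (m choose Suc k) = (m - k) * (m choose k)"
      by (metis binomial_absorb_comp binomial_absorption)
    then show ?thesis
      using True by (metis of_nat_diff of_nat_mult)
  qed (simp add: binomial_eq_0)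
  have "int (Suc k) * int (2 * Suc k choose Suc k) = 2 * (2 * int k + 1) * int (2 * k choose k)"
    using arg_cong[OF Suc_times_central_binomial[of k], of int]
    by (simp only: of_nat_mult of_nat_add of_nat_numeral of_nat_1)
  also have "[\<dots> = 2 * (2 * int k + 1) * (int (m choose k) * (-4) ^ k)] (mod int p)"
    using Suc unfolding m_def by (intro cong_mult cong_refl) auto
  also have "[2 * (2 * int k + 1) * (int (m choose k) * (-4) ^ k)
      = -4 * (int m - int k) * (int (m choose k) * (-4) ^ k)] (mod int p)"
  proof (rule cong_scalar_right)
    have "2 * (2 * int k + 1) - - 4 * (int m - int k) = int p * 2"
      using p by (simp add: algebra_simps)
    then show "[2 * (2 * int k + 1) = - 4 * (int m - int k)] (mod int p)"
      unfolding cong_iff_dvd_diff by (metis dvd_triv_left)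
  qed
  also have "-4 * (int m - int k) * (int (m choose k) * (-4) ^ k)
      = int (Suc k) * (int (m choose Suc k) * (-4) ^ Suc k)"
    using arg_cong[OF step, of "\<lambda>x. x * (-4) ^ Suc k"] by (simp only: power_Suc mult_ac)
  finally have "[int (Suc k) * int (2 * Suc k choose Suc k)
      = int (Suc k) * (int (m choose Suc k) * (-4) ^ Suc k)] (mod int p)" .
  \<comment> \<open>As \<open>Suc k < p\<close>, the common factor \<open>Suc k\<close> is
    invertible modulo \<open>p\<close> and can be cancelled.\<close>
  moreover have "coprime (int (Suc k)) (int p)"
    using assms(1) Suc.prems
    by (metis coprime_commute coprime_int_iff dvd_imp_le linorder_not_less prime_imp_coprime_nat
        zero_less_Suc)
  ultimately show ?case
    unfolding m_def by (simp only: cong_mult_lcancel)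
qed

text \<open>Umbrally, \<open>(1 + x * (1 - A)) ^ m = (1 + x - x * A) ^ m\<close>; at
  \<open>x = -2\<close> the right side is \<open>(-1) ^ m * (1 - 2 * A) ^ m\<close>. The formal
  proof compares the coefficients of each \<open>A j\<close>.\<close>

lemma binomial_transform_neg2:
  fixes A :: "nat \<Rightarrow> 'a::comm_ring_1"
  shows "(\<Sum>k\<le>m. of_nat (m choose k) * (-2) ^ k * (\<Sum>j\<le>k. of_nat (k choose j) * (-1) ^ j * A j))
    = (-1) ^ m * (\<Sum>j\<le>m. of_nat (m choose j) * (-2) ^ j * A j)"
proof -
  \<comment> \<open>Trinomial revision pulls out \<open>m choose j\<close>; after the shift
    \<open>k = i + j\<close> the rest is the binomial expansion of
    \<open>(-2 + 1) ^ (m - j)\<close>.\<close>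
  have inner: "(\<Sum>k\<in>{j..m}. of_nat (m choose k) * of_nat (k choose j) * (-2) ^ k)
      = of_nat (m choose j) * (-2) ^ j * (-1 :: 'a) ^ (m - j)" if "j \<le> m" for j
  proof -
    have "(\<Sum>k\<in>{j..m}. of_nat (m choose k) * of_nat (k choose j) * (-2) ^ k)
        = (\<Sum>k\<in>{j..m}. of_nat (m choose j) * of_nat ((m - j) choose (k - j)) * (-2 :: 'a) ^ k)"
      by (intro sum.cong refl) (simp flip: of_nat_mult add: choose_mult)
    also have "\<dots> = (\<Sum>i\<le>m - j. of_nat (m choose j) * of_nat ((m - j) choose i) * (-2) ^ (i + j))"
      using that by (intro sum.reindex_bij_witness[of _ "\<lambda>i. i + j" "\<lambda>k. k - j"]) auto
    also have "\<dots> = of_nat (m choose j) * (-2) ^ j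
        * (\<Sum>i\<le>m - j. of_nat ((m - j) choose i) * (-2) ^ i * 1 ^ (m - j - i))"
      by (simp add: sum_distrib_left power_add algebra_simps)
    also have "\<dots> = of_nat (m choose j) * (-2) ^ j * (-2 + 1) ^ (m - j)"
      by (simp only: binomial_ring)
    finally show ?thesis by simp
  qed
  have "(\<Sum>k\<le>m. of_nat (m choose k) * (-2) ^ k * (\<Sum>j\<le>k. of_nat (k choose j) * (-1) ^ j * A j))
      = (\<Sum>k\<le>m. \<Sum>j\<le>k. (-1) ^ j * A j * (of_nat (m choose k) * of_nat (k choose j) * (-2) ^ k))"
    by (simp add: sum_distrib_left algebra_simps)
  also have "\<dots> = (\<Sum>j\<le>m. \<Sum>k\<in>{j..m}.
      (-1) ^ j * A j * (of_nat (m choose k) * of_nat (k choose j) * (-2) ^ k))"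
  \<comment> \<open>Both orders of summation run over the triangle
    \<open>j \<le> k \<le> m\<close>.\<close>
  proof -
    have "{j. j \<in> {..m} \<and> j \<le> k} = {..k}" if "k \<le> m" for k
      using that by auto
    moreover have "{k. k \<in> {..m} \<and> j \<le> k} = {j..m}" for j
      by auto
    ultimately show ?thesis
      using sum.swap_restrict[of "{..m}" "{..m}"
        "\<lambda>k j. (-1) ^ j * A j * (of_nat (m choose k) * of_nat (k choose j) * (-2) ^ k)" "\<lambda>k j. j \<le> k"]
      by simp
  qed
  also have "\<dots> = (\<Sum>j\<le>m. (-1) ^ m * (of_nat (m choose j) * (-2) ^ j * A j))"
  proof (intro sum.cong refl)
    fix j assume "j \<in> {..m}"
    then have "j \<le> m" by simp
    then have "(-1 :: 'a) ^ m = (-1) ^ j * (-1) ^ (m - j)"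
      by (simp flip: power_add)
    then show "(\<Sum>k\<in>{j..m}. (-1) ^ j * A j * (of_nat (m choose k) * of_nat (k choose j) * (-2) ^ k))
        = (-1) ^ m * (of_nat (m choose j) * (-2) ^ j * A j)"
      by (simp only: inner[OF \<open>j \<le> m\<close>] flip: sum_distrib_left) (simp add: algebra_simps)
  qed
  finally show ?thesis
    by (simp add: sum_distrib_left)
qed

text \<open>In either case the transform identity says that the sum equals its own negative, which
  over the rationals forces it to be 0.\<close>

lemma even_odd_sequence_sum_eq_0:
  assumes "(even_sequence A \<and> odd m) \<or> (odd_sequence A \<and> even m)"
  shows "(\<Sum>k\<le>m. of_nat (m choose k) * (-2) ^ k * A k) = 0"
  using assms binomial_transform_neg2[of m A]
  unfolding even_sequence_def odd_sequence_def atLeast0AtMost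
  by (auto simp: sum_negf)

theorem theorem4p4:
  fixes p :: nat and A :: "nat \<Rightarrow> rat"
  assumes "prime p" and "odd p"
    and "\<forall>k \<le> (p - 1) div 2. A k \<in> p_integers p"
    and "(even_sequence A \<and> p mod 4 = 3) \<or> (odd_sequence A \<and> p mod 4 = 1)"
  shows "p_cong p (\<Sum>k=0..(p - 1) div 2. of_nat ((2 * k) choose k) / 2 ^ k * A k) 0"
proof -
  define m where "m = (p - 1) div 2"
  define S where "S = (\<Sum>k\<le>m. of_nat ((2 * k) choose k) / 2 ^ k * A k)"
  have p0: "p > 0" and "m < p"
    using prime_gt_0_nat[OF assms(1)] unfolding m_def by auto
  \<comment> \<open>Here \<open>p = 4 * q + 3\<close> gives \<open>m = 2 * q + 1\<close>, and
    \<open>p = 4 * q + 1\<close> gives \<open>m = 2 * q\<close>.\<close>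
  have "p mod 4 = 3 \<Longrightarrow> odd m" "p mod 4 = 1 \<Longrightarrow> even m"
    unfolding m_def by presburger+
  then have T: "(\<Sum>k\<le>m. of_nat (m choose k) * (-2) ^ k * A k) = 0"
    using assms(4) by (intro even_odd_sequence_sum_eq_0) auto
  have "\<exists>d. int (2 * k choose k) - int (m choose k) * (-4) ^ k = int p * d" if "k \<le> m" for k
    using central_binomial_cong[OF assms(1,2), of k] that \<open>m < p\<close>
    unfolding m_def cong_iff_dvd_diff dvd_def by simp
  then obtain d where d: "\<And>k. k \<le> m \<Longrightarrow>
      int (2 * k choose k) - int (m choose k) * (-4) ^ k = int p * d k"
    by metis
  have diff: "of_nat (2 * k choose k) / 2 ^ k - of_nat (m choose k) * (-2) ^ k
      = of_nat p * (of_int (d k) / of_int (2 ^ k) :: rat)" if "k \<le> m" for k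
  proof -
    have "of_nat (2 * k choose k) - of_nat (m choose k) * (-4) ^ k = of_nat p * (of_int (d k) :: rat)"
      using arg_cong[OF d[OF that], of "of_int :: int \<Rightarrow> rat"] by simp
    \<comment> \<open>Dividing the integer congruence by \<open>2 ^ k\<close> thus turns
      \<open>(-4) ^ k\<close> into \<open>(-2) ^ k\<close>.\<close>
    moreover have "(-4 :: rat) ^ k = (-2) ^ k * 2 ^ k"
      by (simp flip: power_mult_distrib)
    ultimately show ?thesis
      by (simp add: field_simps)
  qed
  \<comment> \<open>Subtracting the vanishing sum \<open>T\<close> leaves only coefficients with an
    explicit factor \<open>p\<close>.\<close>
  have "S = (\<Sum>k\<le>m. (of_nat (2 * k choose k) / 2 ^ k - of_nat (m choose k) * (-2) ^ k) * A k)"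
    using T unfolding S_def by (simp add: left_diff_distrib sum_subtractf)
  also have "\<dots> = of_nat p * (\<Sum>k\<le>m. of_int (d k) / of_int (2 ^ k) * A k)"
    unfolding sum_distrib_left by (intro sum.cong refl) (simp only: diff atMost_iff mult.assoc)
  finally have S: "S = of_nat p * (\<Sum>k\<le>m. of_int (d k) / of_int (2 ^ k) * A k)" .
  \<comment> \<open>The powers of 2 are admissible denominators because \<open>p\<close> is odd, and
    each \<open>A k\<close> with \<open>k \<le> m\<close> is a \<open>p\<close>-integer by
    hypothesis.\<close>
  have Q: "(\<Sum>k\<le>m. of_int (d k) / of_int (2 ^ k) * A k) \<in> p_integers p"
    using assms(2,3) unfolding m_def
    by (intro p_integers_sum p_integers_mult p_integers_divide_int) auto
  have "S \<in> p_integers p"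
    unfolding S using p_integers_of_int[of "int p"] Q by (intro p_integers_mult) auto
  moreover have "S / of_nat p \<in> p_integers p"
    using S Q p0 by simp
  ultimately show ?thesis
    using p_integers_of_int[of 0 p]
    unfolding p_cong_def S_def m_def atLeast0AtMost by simp
qed

end
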